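(* Let $G=(V,E)$ be a graph and $X\subseteq V$, and let $\mathcal{S}$ be the set of all forts of $G$. Consider the integer program \[\min \sum_{v\in V}p_v \quad\text{subject to}\quad \sum_{v\in N[F]}p_v\ge 1\ \ \forall F\in\mathcal{S};\qquad p_v=1\ \ \forall v\in X;\qquad p_v\in\{0,1\}\ \ \forall v\in V.\] The optimum value of this integer program equals $\gamma_P(G;X)$.
   Context: All graphs are finite, simple and undirected. $N(v)$ denotes the set of neighbors of $v$, $N[v]=N(v)\cup\{v\}$, $N[S]=\bigcup_{v\in S}N[v]$. A fort of $G$ is a nonempty set $F\subseteq V$ such that no vertex outside $F$ is adjacent to exactly one vertex of $F$. For $S\subseteq V$, the set $PD(S)$ is defined by: initially $PD(S)=N[S]$; while there exists $v\in PD(S)$ with $|N(v)\setminus PD(S)|=1$, replace $PD(S)$ by $PD(S)\cup N(v)$. $S$ is a power dominating set of $G$ if at the end $PD(S)=V$. For $X\subseteq V$, $\gamma_P(G;X)$ is the minimum cardinality of a power dominating set of $G$ containing $X$. *)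

theory Defs
  imports "Graph_Theory.Digraph"
begin

text \<open>A finite simple undirected graph is an instance of the locale \<^locale>\<open>graph\<close>:
  each undirected edge is represented by a pair of opposite arcs.\<close>

definition nbhd :: "('a, 'b) pre_digraph \<Rightarrow> 'a \<Rightarrow> 'a set" where
  "nbhd G v = {u. v \<rightarrow>\<^bsub>G\<^esub> u}"

definition closed_nbhd :: "('a, 'b) pre_digraph \<Rightarrow> 'a \<Rightarrow> 'a set" where
  "closed_nbhd G v = nbhd G v \<union> {v}"

definition closed_nbhd_set :: "('a, 'b) pre_digraph \<Rightarrow> 'a set \<Rightarrow> 'a set" where
  "closed_nbhd_set G S = (\<Union>v\<in>S. closed_nbhd G v)"

definition fort :: "('a, 'b) pre_digraph \<Rightarrow> 'a set \<Rightarrow> bool" where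
  "fort G F \<longleftrightarrow> F \<noteq> {} \<and> F \<subseteq> verts G \<and>
     \<not> (\<exists>v \<in> verts G - F. card (nbhd G v \<inter> F) = 1)"

inductive pd_step :: "('a, 'b) pre_digraph \<Rightarrow> 'a set \<Rightarrow> 'a set \<Rightarrow> bool" for G where
  "v \<in> P \<Longrightarrow> card (nbhd G v - P) = 1 \<Longrightarrow> pd_step G P (P \<union> nbhd G v)"

definition pd_result :: "('a, 'b) pre_digraph \<Rightarrow> 'a set \<Rightarrow> 'a set \<Rightarrow> bool" where
  "pd_result G S P \<longleftrightarrow>
     (pd_step G)\<^sup>*\<^sup>* (closed_nbhd_set G S) P \<and> \<not> (\<exists>Q. pd_step G P Q)"

text \<open>The choice of the forcing vertex in each step is arbitrary; the lemma
  \<open>ex1_pd_result\<close> below shows that the process always stops and that the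
  final set does not depend on these choices.\<close>

definition PD :: "('a, 'b) pre_digraph \<Rightarrow> 'a set \<Rightarrow> 'a set" where
  "PD G S = (THE P. pd_result G S P)"

definition power_dominating :: "('a, 'b) pre_digraph \<Rightarrow> 'a set \<Rightarrow> bool" where
  "power_dominating G S \<longleftrightarrow> S \<subseteq> verts G \<and> PD G S = verts G"

definition gamma_P :: "('a, 'b) pre_digraph \<Rightarrow> 'a set \<Rightarrow> nat" where
  "gamma_P G X = Min (card ` {S. power_dominating G S \<and> X \<subseteq> S})"

definition ip_feasible :: "('a, 'b) pre_digraph \<Rightarrow> 'a set \<Rightarrow> ('a \<Rightarrow> int) \<Rightarrow> bool" where
  "ip_feasible G X p \<longleftrightarrow>
     (\<forall>F. fort G F \<longrightarrow> (\<Sum>v\<in>closed_nbhd_set G F. p v) \<ge> 1) \<and>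
     (\<forall>v\<in>X. p v = 1) \<and>
     (\<forall>v\<in>verts G. p v \<in> {0, 1})"

definition ip_objective :: "('a, 'b) pre_digraph \<Rightarrow> ('a \<Rightarrow> int) \<Rightarrow> int" where
  "ip_objective G p = (\<Sum>v\<in>verts G. p v)"

definition is_min_value :: "('p \<Rightarrow> bool) \<Rightarrow> ('p \<Rightarrow> int) \<Rightarrow> int \<Rightarrow> bool" where
  "is_min_value feasible objective c \<longleftrightarrow>
     (\<exists>p. feasible p \<and> objective p = c) \<and> (\<forall>p. feasible p \<longrightarrow> c \<le> objective p)"

lemma (in wf_digraph) nbhd_subset_verts: "nbhd G v \<subseteq> verts G"
  by (auto simp: nbhd_def arcs_ends_def arc_to_ends_def)

lemma pd_steps_subset_final:
  assumes "(pd_step G)\<^sup>*\<^sup>* A P" "A \<subseteq> Q" "\<not> (\<exists>R. pd_step G Q R)"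
  shows "P \<subseteq> Q"
  using assms(1)
proof induction
  case base
  show ?case by (fact assms(2))
next
  case (step P P')
  from step.hyps(2) show ?case
  proof cases
    case (1 v)
    then obtain w where w: "nbhd G v - P = {w}"
      by (auto simp: card_1_singleton_iff)
    have "card (nbhd G v - Q) \<noteq> 1"
      using 1 step.IH assms(3) pd_step.intros[of v Q G] by blast
    moreover have "nbhd G v - Q \<subseteq> {w}"
      unfolding w[symmetric] using step.IH by (rule Diff_mono[OF subset_refl])
    then have "nbhd G v - Q = {} \<or> nbhd G v - Q = {w}"
      by (rule subset_singletonD)
    ultimately have "nbhd G v - Q = {}" by auto
    with 1 step.IH show ?thesis by blast
  qed
qed

lemma pd_steps_mono: "(pd_step G)\<^sup>*\<^sup>* A P \<Longrightarrow> A \<subseteq> P"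
  by (induction rule: rtranclp_induct) (auto elim!: pd_step.cases)

lemma (in fin_digraph) pd_terminates:
  assumes "P \<subseteq> verts G"
  shows "\<exists>Q. (pd_step G)\<^sup>*\<^sup>* P Q \<and> \<not> (\<exists>R. pd_step G Q R)"
  using assms
proof (induction "card (verts G - P)" arbitrary: P rule: less_induct)
  case less
  show ?case
  proof (cases "\<exists>R. pd_step G P R")
    case False
    then show ?thesis by blast
  next
    case True
    then obtain R where R: "pd_step G P R" by blast
    then obtain v where v: "card (nbhd G v - P) = 1" "R = P \<union> nbhd G v"
      by (auto elim: pd_step.cases)
    have "nbhd G v - P \<noteq> {}" using v(1) by (metis card.empty zero_neq_one)
    then have "verts G - R \<subset> verts G - P"
      using v(2) nbhd_subset_verts[of v] by blast
    then have "card (verts G - R) < card (verts G - P)"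
      by (intro psubset_card_mono) auto
    moreover have "R \<subseteq> verts G" using v(2) less.prems nbhd_subset_verts by blast
    ultimately obtain Q where "(pd_step G)\<^sup>*\<^sup>* R Q" "\<not> (\<exists>R. pd_step G Q R)"
      using less.hyps by blast
    with R show ?thesis by (meson converse_rtranclp_into_rtranclp)
  qed
qed

lemma (in fin_digraph) ex1_pd_result:
  assumes "S \<subseteq> verts G"
  shows "\<exists>!P. pd_result G S P"
proof -
  have "closed_nbhd_set G S \<subseteq> verts G"
    using assms nbhd_subset_verts by (auto simp: closed_nbhd_set_def closed_nbhd_def)
  from pd_terminates[OF this] obtain P where "pd_result G S P"
    by (auto simp: pd_result_def)
  moreover have "P \<subseteq> Q" if "pd_result G S P" "pd_result G S Q" for P Q
    using that pd_steps_subset_final pd_steps_mono unfolding pd_result_def by metis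
  ultimately show ?thesis by blast
qed

end

theory Submission
  imports Defs
begin

text \<open>The complement of a set that is closed under the forcing steps is, when nonempty, a fort, and
  the complement of a fort is closed under the forcing steps. Hence \<open>S\<close> fails to be power
  dominating iff some fort avoids \<open>N[S]\<close>, i.e. iff \<open>S\<close> avoids \<open>N[F]\<close> for some fort \<open>F\<close>. The
  feasible points of the program are therefore the indicator functions of the power dominating
  sets containing \<open>X\<close>.\<close>

lemma (in wf_digraph) closed_nbhd_set_subset_verts:
  "S \<subseteq> verts G \<Longrightarrow> closed_nbhd_set G S \<subseteq> verts G"
  using nbhd_subset_verts by (auto simp: closed_nbhd_set_def closed_nbhd_def)

lemma subset_closed_nbhd_set: "S \<subseteq> closed_nbhd_set G S"
  by (auto simp: closed_nbhd_set_def closed_nbhd_def)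

lemma (in sym_digraph) nbhd_commute: "u \<in> nbhd G v \<longleftrightarrow> v \<in> nbhd G u"
  using sym_arcs by (auto simp: nbhd_def symmetric_def dest: symD)

text \<open>By symmetry of adjacency, both sides say that no vertex of \<open>A\<close> equals or
  neighbors a vertex of \<open>B\<close>. This trades "\<open>N[S]\<close> avoids \<open>F\<close>"
  for "\<open>S\<close> avoids \<open>N[F]\<close>", the form that occurs in the program.\<close>

lemma (in sym_digraph) closed_nbhd_set_disjoint_commute:
  "A \<inter> closed_nbhd_set G B = {} \<longleftrightarrow> B \<inter> closed_nbhd_set G A = {}"
  using nbhd_commute by (fastforce simp: closed_nbhd_set_def closed_nbhd_def)

lemma (in fin_digraph) pd_result_PD: "S \<subseteq> verts G \<Longrightarrow> pd_result G S (PD G S)"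
  unfolding PD_def by (rule theI'[OF ex1_pd_result])

text \<open>The neighbors of \<open>v\<close> not in \<open>P\<close> are exactly its neighbors in
  the complement of \<open>P\<close>, so a vertex that can force is the same as a vertex violating
  the fort condition. Strict inclusion makes the complement nonempty.\<close>

lemma (in wf_digraph) fort_Diff_iff_no_pd_step:
  assumes "P \<subset> verts G"
  shows "fort G (verts G - P) \<longleftrightarrow> \<not> (\<exists>Q. pd_step G P Q)"
proof -
  have "nbhd G v \<inter> (verts G - P) = nbhd G v - P" for v
    using nbhd_subset_verts[of v] by blast
  moreover have "verts G - (verts G - P) = P" using assms by blast
  ultimately show ?thesis
    using assms by (auto simp: fort_def pd_step.simps)
qed

lemma (in wf_digraph) no_pd_step_verts: "\<not> pd_step G (verts G) Q"
proof
  assume "pd_step G (verts G) Q"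
  then obtain v where "card (nbhd G v - verts G) = 1" by (auto elim: pd_step.cases)
  moreover have "nbhd G v - verts G = {}" using nbhd_subset_verts by blast
  ultimately show False by simp
qed

lemma (in graph) power_dominating_iff_meets_forts:
  assumes S: "S \<subseteq> verts G"
  shows "power_dominating G S \<longleftrightarrow> (\<forall>F. fort G F \<longrightarrow> S \<inter> closed_nbhd_set G F \<noteq> {})"
proof (intro iffI allI impI notI)
  fix F
  assume pd: "power_dominating G S" and F: "fort G F" and "S \<inter> closed_nbhd_set G F = {}"
  then have "closed_nbhd_set G S \<subseteq> verts G - F"
    using closed_nbhd_set_disjoint_commute closed_nbhd_set_subset_verts[OF S] by blast
  moreover have F': "F \<subseteq> verts G" "F \<noteq> {}" using F by (auto simp: fort_def)
  \<comment> \<open>The double complement is \<open>F\<close> again, and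
    \<open>F \<noteq> {}\<close> makes the inclusion of its complement strict.\<close>
  then have "\<not> (\<exists>Q. pd_step G (verts G - F) Q)"
    using F fort_Diff_iff_no_pd_step[of "verts G - F"] by (simp add: double_diff psubset_eq) blast
  \<comment> \<open>The process starts inside a set that admits no step, so it can never leave
    it.\<close>
  ultimately have "PD G S \<subseteq> verts G - F"
    using pd_result_PD[OF S] pd_steps_subset_final unfolding pd_result_def by metis
  then show False using pd F' by (auto simp: power_dominating_def)
next
  assume meets: "\<forall>F. fort G F \<longrightarrow> S \<inter> closed_nbhd_set G F \<noteq> {}"
  \<comment> \<open>The upper bound \<open>verts G\<close> comes from the same trapping argument,
    since \<open>verts G\<close> admits no step either.\<close>
  have PD: "closed_nbhd_set G S \<subseteq> PD G S" "\<not> (\<exists>Q. pd_step G (PD G S) Q)"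
    "PD G S \<subseteq> verts G"
    using pd_result_PD[OF S] pd_steps_mono closed_nbhd_set_subset_verts[OF S]
      pd_steps_subset_final no_pd_step_verts
    unfolding pd_result_def by metis+
  have "PD G S = verts G"
  proof (rule ccontr)
    assume "PD G S \<noteq> verts G"
    then have "fort G (verts G - PD G S)"
      using PD fort_Diff_iff_no_pd_step by blast
    moreover have "S \<inter> closed_nbhd_set G (verts G - PD G S) = {}"
      using PD(1) closed_nbhd_set_disjoint_commute by blast
    ultimately show False using meets by blast
  qed
  then show "power_dominating G S" using S by (simp add: power_dominating_def)
qed

text \<open>A sum of nonnegative integers is below 1 only if it is 0, that is, if every term
  vanishes.\<close>

lemma sum_zero_one_ge_one_iff:
  fixes p :: "'a \<Rightarrow> int"
  assumes "finite A" "\<And>v. v \<in> A \<Longrightarrow> p v \<in> {0, 1}"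
  shows "1 \<le> sum p A \<longleftrightarrow> (\<exists>v\<in>A. p v = 1)"
proof -
  have "sum p A = 0 \<longleftrightarrow> (\<forall>v\<in>A. p v = 0)" "0 \<le> sum p A"
    using assms by (force intro!: sum_nonneg_eq_0_iff sum_nonneg)+
  then show ?thesis using assms(2) by fastforce
qed

text \<open>For 0/1 values, a fort constraint says that the support of \<open>p\<close> meets
  \<open>N[F]\<close>. The support is cut down to \<open>verts G\<close> because \<open>p\<close> is
  a total function with arbitrary values elsewhere.\<close>

lemma (in graph) ip_feasible_iff:
  assumes X: "X \<subseteq> verts G"
  shows "ip_feasible G X p \<longleftrightarrow> (\<forall>v\<in>verts G. p v \<in> {0, 1}) \<and>
    X \<subseteq> {v \<in> verts G. p v = 1} \<and> power_dominating G {v \<in> verts G. p v = 1}"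
proof (cases "\<forall>v\<in>verts G. p v \<in> {0, 1}")
  case True
  have "1 \<le> sum p (closed_nbhd_set G F) \<longleftrightarrow> {v \<in> verts G. p v = 1} \<inter> closed_nbhd_set G F \<noteq> {}"
    if "fort G F" for F
  proof -
    have sub: "closed_nbhd_set G F \<subseteq> verts G"
      using that closed_nbhd_set_subset_verts by (simp add: fort_def)
    then have "1 \<le> sum p (closed_nbhd_set G F) \<longleftrightarrow> (\<exists>v\<in>closed_nbhd_set G F. p v = 1)"
      using True by (intro sum_zero_one_ge_one_iff) (auto intro: finite_subset)
    then show ?thesis using sub by blast
  qed
  then show ?thesis
    using True X by (subst power_dominating_iff_meets_forts) (auto simp: ip_feasible_def)
next
  case False
  then show ?thesis by (auto simp: ip_feasible_def)
qed

lemma (in graph) ip_objective_eq_card: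
  assumes "\<forall>v\<in>verts G. p v \<in> {0, 1}"
  shows "ip_objective G p = int (card {v \<in> verts G. p v = 1})"
proof -
  have "ip_objective G p = (\<Sum>v\<in>verts G. if p v = 1 then 1 else 0)"
    unfolding ip_objective_def using assms by (intro sum.cong) auto
  then show ?thesis by (simp add: sum.If_cases Int_def)
qed

text \<open>Every fort is nonempty and lies in its own closed neighborhood, so
  \<open>verts G\<close> meets them all.\<close>

lemma (in graph) power_dominating_verts: "power_dominating G (verts G)"
  using subset_closed_nbhd_set by (subst power_dominating_iff_meets_forts) (fastforce simp: fort_def)+

theorem theorem4p4:
  fixes G :: "('a, 'b) pre_digraph" and X :: "'a set"
  assumes "graph G" and "X \<subseteq> verts G"
  shows "is_min_value (ip_feasible G X) (ip_objective G) (int (gamma_P G X))"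
proof -
  interpret graph G by fact
  let ?C = "{S. power_dominating G S \<and> X \<subseteq> S}"
  have "?C \<subseteq> Pow (verts G)" by (auto simp: power_dominating_def)
  then have fin: "finite (card ` ?C)" by (simp add: finite_subset)
  \<comment> \<open>\<open>Min\<close> is meaningful only on a finite nonempty set;
    \<open>verts G\<close> is a member of \<open>?C\<close>.\<close>
  have "card ` ?C \<noteq> {}" using power_dominating_verts assms(2) by blast
  with fin have "gamma_P G X \<in> card ` ?C" unfolding gamma_P_def by (rule Min_in)
  then obtain S where S: "power_dominating G S" "X \<subseteq> S" "gamma_P G X = card S" by blast
  \<comment> \<open>The optimum is attained at the indicator function of a minimum set
    \<open>S\<close>.\<close>
  define p :: "'a \<Rightarrow> int" where "p v = (if v \<in> S then 1 else 0)" for v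
  have "{v \<in> verts G. p v = 1} = S"
    using S(1) by (auto simp: p_def power_dominating_def)
  then have "ip_feasible G X p" "ip_objective G p = int (gamma_P G X)"
    using S by (auto simp: ip_feasible_iff[OF assms(2)] ip_objective_eq_card p_def)
  \<comment> \<open>The support of \<open>q\<close> belongs to \<open>?C\<close>, and its
    cardinality is the objective value.\<close>
  moreover have "int (gamma_P G X) \<le> ip_objective G q" if "ip_feasible G X q" for q
    using that fin
    by (auto simp: ip_feasible_iff[OF assms(2)] ip_objective_eq_card gamma_P_def intro!: Min_le)
  ultimately show ?thesis unfolding is_min_value_def by blast
qed

end
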